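(* Let $r = 2k+1 \geq 5$ be an odd integer, let $n$ be a positive integer divisible by $r$, and let $\nu_n = (1,2,\ldots,n)$ be the natural cyclic order on $\{1,\ldots,n\}$. Then $$mbt\bigl(C(n,\{1,2,\ldots,k\}),\nu_n\bigr) = 2k+1.$$
   Context: All graphs are finite and simple. For a set $S=\{i_1<\cdots<i_k\}$ of integers with $k\ge 1$, $1\le i_1$ and $i_k\le \lfloor n/2\rfloor$, the circulant $C(n,S)$ is the graph on vertex set $\{1,\ldots,n\}$ in which each $j$ is adjacent to $j+i_r$ (addition mod $n$) for $r=1,\ldots,k$. Given a graph $G$ and a cyclic order $\omega$ on $V(G)$, draw the vertices on a circle in the order $\omega$ and the edges as straight chords; two edges cross if they intersect at a point that is not an endpoint. A matching book embedding $(G,\omega,c)$ consists of $G$, a cyclic order $\omega$, and an edge-coloring $c$ (the color classes are the pages) such that any two distinct edges of the same color neither cross nor share an endpoint. The number $mbt(G,\omega)$ is the least number of colors in any matching book embedding $(G,\omega,c)$ with the given cyclic order $\omega$. *)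

theory Defs
  imports "HOL-Analysis.Analysis" "HOL-Number_Theory.Cong"
begin

type_synonym 'a graph = "'a set \<times> 'a set set"

definition vertices :: "'a graph \<Rightarrow> 'a set" where
  "vertices G = fst G"

definition edges :: "'a graph \<Rightarrow> 'a set set" where
  "edges G = snd G"

definition finite_simple_graph :: "'a graph \<Rightarrow> bool" where
  "finite_simple_graph G \<longleftrightarrow>
     finite (vertices G) \<and> (\<forall>e\<in>edges G. e \<subseteq> vertices G \<and> card e = 2)"

text \<open>
  Addition modulo \<open>n\<close> is taken on the representatives \<open>1, \<dots>, n\<close>. The jump set \<open>S\<close> is meant to be a
  nonempty subset of \<open>{1..n div 2}\<close>; then no loops arise, see \<open>finite_simple_graph_circulant\<close>.
\<close>
definition circulant :: "nat \<Rightarrow> nat set \<Rightarrow> nat graph" where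
  "circulant n S =
     ({1..n}, {{x, y} |x y. x \<in> {1..n} \<and> y \<in> {1..n} \<and> (\<exists>i\<in>S. [y = x + i] (mod n))})"

text \<open>
  A cyclic order on a finite set is given by a list enumerating the set without repetition, read
  cyclically; two lists that are rotations of each other represent the same cyclic order.
\<close>
definition cyclic_order_on :: "'a set \<Rightarrow> 'a list \<Rightarrow> bool" where
  "cyclic_order_on V \<omega> \<longleftrightarrow> distinct \<omega> \<and> set \<omega> = V"

definition natural_cyclic_order :: "nat \<Rightarrow> nat list" where
  "natural_cyclic_order n = [1..<Suc n]"

text \<open>
  The drawing places the vertices equally spaced on the unit circle, in the given order. Whether
  two chords meet depends only on the cyclic order of their ends, so the spacing is immaterial,
  and rotating the list merely rotates the drawing.
\<close>
definition vertex_point :: "'a list \<Rightarrow> 'a \<Rightarrow> complex" where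
  "vertex_point \<omega> v =
     cis (2 * pi * real (THE i. i < length \<omega> \<and> \<omega> ! i = v) / real (length \<omega>))"

text \<open>For an edge \<open>{u, v}\<close> this is the closed segment between the points of \<open>u\<close> and \<open>v\<close>.\<close>
definition chord :: "'a list \<Rightarrow> 'a set \<Rightarrow> complex set" where
  "chord \<omega> e = convex hull (vertex_point \<omega> ` e)"

text \<open>Only meant for distinct edges \<open>e\<close> and \<open>f\<close>.\<close>
definition edges_cross :: "'a list \<Rightarrow> 'a set \<Rightarrow> 'a set \<Rightarrow> bool" where
  "edges_cross \<omega> e f \<longleftrightarrow>
     (\<exists>p. p \<in> chord \<omega> e \<inter> chord \<omega> f \<and> p \<notin> vertex_point \<omega> ` (e \<union> f))"

definition matching_book_embedding :: "'a graph \<Rightarrow> 'a list \<Rightarrow> ('a set \<Rightarrow> nat) \<Rightarrow> bool" where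
  "matching_book_embedding G \<omega> c \<longleftrightarrow>
     finite_simple_graph G \<and> cyclic_order_on (vertices G) \<omega> \<and>
     (\<forall>e\<in>edges G. \<forall>f\<in>edges G. e \<noteq> f \<and> c e = c f \<longrightarrow> \<not> edges_cross \<omega> e f \<and> e \<inter> f = {})"

definition mbt :: "'a graph \<Rightarrow> 'a list \<Rightarrow> nat" where
  "mbt G \<omega> = (LEAST m. \<exists>c. matching_book_embedding G \<omega> c \<and> card (c ` edges G) = m)"

lemma finite_simple_graph_circulant:
  assumes "S \<subseteq> {1..n div 2}"
  shows "finite_simple_graph (circulant n S)"
proof -
  have "x \<noteq> y" if "x \<in> {1..n}" "i \<in> S" "[y = x + i] (mod n)" for x y i
  proof
    assume "x = y"
    with that(3) have "[x + 0 = x + i] (mod n)" by simp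
    then have "[0 = i] (mod n)" by (simp only: cong_add_lcancel_nat)
    then have "n dvd i" by (metis cong_0_iff cong_sym)
    moreover have "0 < i" "i < n" using assms that by force+
    ultimately show False by (simp add: nat_dvd_not_less)
  qed
  then show ?thesis
    by (fastforce simp: finite_simple_graph_def circulant_def vertices_def edges_def card_2_iff)
qed

text \<open>The minimum in \<open>mbt\<close> is attained: one may give every edge its own page.\<close>
lemma ex_matching_book_embedding:
  fixes G :: "'a graph"
  assumes "finite_simple_graph G" "cyclic_order_on (vertices G) \<omega>"
  shows "\<exists>c. matching_book_embedding G \<omega> c"
proof -
  have "finite (edges G)"
    using assms(1) unfolding finite_simple_graph_def
    by (meson Pow_iff finite_Pow_iff finite_subset subsetI)
  then obtain c :: "'a set \<Rightarrow> nat" where "inj_on c (edges G)"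
    using finite_imp_inj_to_nat_seg by blast
  then have "matching_book_embedding G \<omega> c"
    using assms by (auto simp: matching_book_embedding_def dest: inj_onD)
  then show ?thesis by (rule exI[of _ c])
qed

end

theory Submission
  imports Defs
begin

text \<open>
  Upper bound: colour the edge \<open>{x, y}\<close> by \<open>x + y\<close> modulo \<open>r\<close>, which is compatible with addition
  modulo \<open>n\<close> because \<open>r\<close> divides \<open>n\<close>. If two edges of cyclic length at most \<open>k\<close> share an end or
  cross, then their colours differ by the residue of a nonzero integer of absolute value at most
  \<open>2k < r\<close>.

  Lower bound: the graph is \<open>2k\<close>-regular, so with only \<open>2k\<close> pages every vertex meets every page.
  Since \<open>k \<ge> 2\<close>, the edge joining the two cyclic neighbours of a vertex \<open>v\<close> exists, and it crosses
  the edge at \<open>v\<close> that lies on its page.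
\<close>

section \<open>Orientation and crossing chords\<close>

text \<open>Twice the signed area of the triangle \<open>a b z\<close>, positive for a
  counterclockwise one; its sign tells on which side of the line through \<open>a\<close> and
  \<open>b\<close> the point \<open>z\<close> lies.\<close>

definition orient :: "complex \<Rightarrow> complex \<Rightarrow> complex \<Rightarrow> real" where
  "orient a b z = (Re b - Re a) * (Im z - Im a) - (Im b - Im a) * (Re z - Re a)"

lemma orient_rotate: "orient b c a = orient a b c"
  by (simp add: orient_def algebra_simps)

lemma orient_swap: "orient a c b = - orient a b c"
  by (simp add: orient_def algebra_simps)

lemma orient_convex_combination:
  assumes "u + v = 1"
  shows "orient a b (u *\<^sub>R c + v *\<^sub>R d) = u * orient a b c + v * orient a b d"
proof -
  have u: "u = 1 - v" using assms by simp
  show ?thesis unfolding u by (simp add: orient_def algebra_simps)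
qed

lemma orient_on_segment:
  assumes "p \<in> convex hull {a, b}"
  shows "orient a b p = 0"
  using assms
  by (auto simp: convex_hull_2 orient_convex_combination) (simp add: orient_def)

lemma orient_pos_on_segment:
  assumes "p \<in> convex hull {c, d}" "orient a b c > 0" "orient a b d > 0"
  shows "orient a b p > 0"
proof -
  obtain u v where uv: "0 \<le> u" "0 \<le> v" "u + v = 1" and p: "p = u *\<^sub>R c + v *\<^sub>R d"
    using assms(1) by (auto simp: convex_hull_2)
  show ?thesis
  proof (cases "u = 0")
    case False
    then have "u * orient a b c > 0" "v * orient a b d \<ge> 0" using uv assms by auto
    then show ?thesis using uv p by (simp add: orient_convex_combination)
  qed (use uv p assms in auto)
qed

text \<open>A positive product puts \<open>c\<close> and \<open>d\<close>, hence the whole segment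
  between them, strictly on one side of the line through \<open>a\<close> and
  \<open>b\<close>.\<close>

lemma convex_hulls_disjoint:
  assumes "orient a b c * orient a b d > 0"
  shows "convex hull {a, b} \<inter> convex hull {c, d} = {}"
proof -
  have "p \<notin> convex hull {c, d}" if p: "p \<in> convex hull {a, b}" for p
  proof
    assume q: "p \<in> convex hull {c, d}"
    have 0: "orient a b p = 0" "orient b a p = 0"
      using p orient_on_segment by (auto simp: insert_commute)
    \<comment> \<open>Exchanging \<open>a\<close> and \<open>b\<close> reduces two negative factors
      to two positive ones.\<close>
    have swap: "orient b a z = - orient a b z" for z
      by (simp add: orient_def algebra_simps)
    show False
      using assms orient_pos_on_segment[OF q, of a b] orient_pos_on_segment[OF q, of b a] 0
      by (auto simp: zero_less_mult_iff swap)
  qed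
  then show ?thesis by blast
qed

lemma convex_combination_in_hull:
  fixes a b :: "'a::real_vector"
  assumes "u + v = 1" "0 \<le> u" "0 \<le> v"
  shows "u *\<^sub>R a + v *\<^sub>R b \<in> convex hull {a, b}"
  using assms by (auto simp: convex_hull_2)

lemma segments_meet:
  assumes "orient a b c < 0" "orient a b d > 0" "orient c d a > 0" "orient c d b < 0"
  shows "\<exists>p. p \<in> convex hull {a, b} \<inter> convex hull {c, d} \<and> p \<notin> {a, b, c, d}"
proof -
  define D where "D = orient a b d - orient a b c"
  have D: "D > 0" using assms by (simp add: D_def)
  have D': "D = orient c d a - orient c d b"
    by (simp add: D_def orient_def algebra_simps)
  \<comment> \<open>The weights make the affine function \<open>orient a b\<close> vanish at
    \<open>p\<close>.\<close>
  define p where "p = (orient a b d / D) *\<^sub>R c + (- orient a b c / D) *\<^sub>R d"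
  have "D *\<^sub>R p = orient a b d *\<^sub>R c - orient a b c *\<^sub>R d"
    using D by (simp add: p_def scaleR_right_diff_distrib)
  \<comment> \<open>The affine dependence of four points in the plane, with signed areas as
    coefficients, rewrites \<open>p\<close> in terms of \<open>a\<close> and
    \<open>b\<close>.\<close>
  also have "\<dots> = - orient c d b *\<^sub>R a + orient c d a *\<^sub>R b"
    by (simp add: complex_eq_iff orient_def algebra_simps)
  also have "\<dots> = D *\<^sub>R ((- orient c d b / D) *\<^sub>R a + (orient c d a / D) *\<^sub>R b)"
    using D by (simp add: scaleR_add_right scaleR_right_diff_distrib)
  finally have p': "p = (- orient c d b / D) *\<^sub>R a + (orient c d a / D) *\<^sub>R b"
    using D by simp
  have "p \<in> convex hull {c, d}"
    unfolding p_def
  proof (rule convex_combination_in_hull)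
    show "orient a b d / D + - orient a b c / D = 1"
      using D by (simp add: D_def flip: diff_divide_distrib)
  qed (use D assms in \<open>auto simp: divide_le_0_iff\<close>)
  moreover have "p \<in> convex hull {a, b}"
    unfolding p'
  proof (rule convex_combination_in_hull)
    show "- orient c d b / D + orient c d a / D = 1"
      using D by (simp add: D' flip: diff_divide_distrib)
  qed (use D assms in \<open>auto simp: divide_le_0_iff\<close>)
  \<comment> \<open>\<open>p\<close> lies on both lines, while no end of one segment lies on the
    line of the other.\<close>
  moreover have "p \<notin> {a, b, c, d}"
    using orient_on_segment[OF calculation(1)] orient_on_segment[OF calculation(2)] assms by auto
  ultimately show ?thesis by blast
qed

text \<open>Signed form of the area formula \<open>2 sin A sin B sin C\<close> for a triangle
  inscribed in the unit circle: inscribed angles are half the central ones.\<close>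

lemma orient_cis:
  "orient (cis \<alpha>) (cis \<beta>) (cis \<theta>) =
     4 * sin ((\<beta> - \<alpha>) / 2) * sin ((\<theta> - \<beta>) / 2) * sin ((\<theta> - \<alpha>) / 2)"
proof -
  define p q where "p = (\<beta> - \<alpha>) / 2" and "q = (\<theta> - \<beta>) / 2"
  have eqs: "\<beta> = \<alpha> + 2 * p" "\<theta> = \<alpha> + 2 * p + 2 * q" "(\<theta> - \<alpha>) / 2 = p + q"
    by (auto simp: p_def q_def field_simps)
  have "orient (cis \<alpha>) (cis \<beta>) (cis \<theta>) = sin (\<beta> - \<alpha>) + sin (\<theta> - \<beta>) - sin (\<theta> - \<alpha>)"
    by (simp add: orient_def sin_diff algebra_simps)
  also have "\<dots> = sin (2 * p) + sin (2 * q) - sin (2 * p + 2 * q)"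
    by (simp add: eqs)
  also have "\<dots> = sin (2 * p) * (1 - cos (2 * q)) + sin (2 * q) * (1 - cos (2 * p))"
    by (simp add: sin_add algebra_simps)
  also have "\<dots> = 2 * sin p * cos p * (2 * (sin q)\<^sup>2) + 2 * sin q * cos q * (2 * (sin p)\<^sup>2)"
    by (simp add: sin_double cos_double_sin)
  also have "\<dots> = 4 * sin p * sin q * sin (p + q)"
    by (simp add: sin_add power2_eq_square algebra_simps)
  finally show ?thesis
    by (simp only: p_def [symmetric] q_def [symmetric] eqs(3))
qed

section \<open>The natural cyclic order\<close>

lemma vertex_point_natural:
  assumes "v \<in> {1..n}"
  shows "vertex_point (natural_cyclic_order n) v = cis (2 * pi * real (v - 1) / real n)"
proof -
  have "(THE i. i < n \<and> [1..<Suc n] ! i = v) = v - 1"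
    using assms by (intro the_equality) (auto simp del: upt_Suc)
  then show ?thesis
    by (simp add: vertex_point_def natural_cyclic_order_def del: upt_Suc)
qed

lemma orient_natural_pos:
  fixes n :: nat
  assumes "1 \<le> x" "x < y" "y < z" "z \<le> n"
  defines "P \<equiv> vertex_point (natural_cyclic_order n)"
  shows "orient (P x) (P y) (P z) > 0"
proof -
  \<comment> \<open>Half the angle from a vertex to a later one lies strictly between 0 and
    \<open>pi\<close>, so all three sines in \<open>orient_cis\<close> are positive.\<close>
  have pos: "sin ((2 * pi * real (w - 1) / real n - 2 * pi * real (v - 1) / real n) / 2) > 0"
    if "1 \<le> v" "v < w" "w \<le> n" for v w
  proof (rule sin_gt_zero)
    have eq: "(2 * pi * real (w - 1) / real n - 2 * pi * real (v - 1) / real n) / 2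
        = pi * (real (w - v) / real n)"
      using that by (simp add: of_nat_diff field_simps)
    define t where "t = real (w - v) / real n"
    have "t > 0" "t < 1"
      using that by (auto simp: t_def field_simps)
    then show "(2 * pi * real (w - 1) / real n - 2 * pi * real (v - 1) / real n) / 2 > 0"
      "(2 * pi * real (w - 1) / real n - 2 * pi * real (v - 1) / real n) / 2 < pi"
      unfolding eq t_def [symmetric] by simp_all
  qed
  show ?thesis
    using assms pos[of x y] pos[of y z] pos[of x z]
    by (simp add: P_def vertex_point_natural orient_cis)
qed

text \<open>When the ends alternate, each chord separates the ends of the other, as
  \<open>segments_meet\<close> requires.\<close>

lemma interleaved_edges_cross:
  assumes "1 \<le> x" "x < x'" "x' < y" "y < y'" "y' \<le> n"
  shows "edges_cross (natural_cyclic_order n) {x, y} {x', y'}"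
proof -
  let ?P = "vertex_point (natural_cyclic_order n)"
  have "orient (?P x) (?P y) (?P x') < 0"
    using orient_natural_pos[of x x' y n] assms orient_swap[of "?P x" "?P x'"] by simp
  moreover have "orient (?P x) (?P y) (?P y') > 0"
    using orient_natural_pos[of x y y' n] assms by simp
  moreover have "orient (?P x') (?P y') (?P x) > 0"
    using orient_natural_pos[of x x' y' n] assms by (simp add: orient_rotate)
  moreover have "orient (?P x') (?P y') (?P y) < 0"
    using orient_natural_pos[of x' y y' n] assms orient_swap[of "?P x'" "?P y"] by simp
  ultimately show ?thesis
    using segments_meet[of "?P x" "?P y" "?P x'" "?P y'"]
    by (auto simp: edges_cross_def chord_def)
qed

text \<open>Only for \<open>z\<close> between \<open>x\<close> and \<open>y\<close> is the triple an
  odd permutation of an increasing one; the other positions give even permutations.\<close>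

lemma orient_natural_neg_iff:
  fixes n :: nat
  assumes "{x, y, z} \<subseteq> {1..n}" "x < y" "z \<noteq> x" "z \<noteq> y"
  defines "P \<equiv> vertex_point (natural_cyclic_order n)"
  shows "orient (P x) (P y) (P z) \<noteq> 0" "orient (P x) (P y) (P z) < 0 \<longleftrightarrow> x < z \<and> z < y"
proof -
  consider "z < x" | "x < z" "z < y" | "y < z" using assms by linarith
  then have "orient (P x) (P y) (P z) \<noteq> 0 \<and>
    (orient (P x) (P y) (P z) < 0 \<longleftrightarrow> x < z \<and> z < y)"
  proof cases
    case 1
    then show ?thesis
      using orient_natural_pos[of z x y n] assms by (simp add: orient_rotate)
  next
    case 2
    then show ?thesis
      using orient_natural_pos[of x z y n] assms orient_swap[of "P x" "P z" "P y"] by simp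
  next
    case 3
    then show ?thesis
      using orient_natural_pos[of x y z n] assms by simp
  qed
  then show "orient (P x) (P y) (P z) \<noteq> 0" "orient (P x) (P y) (P z) < 0 \<longleftrightarrow> x < z \<and> z < y"
    by auto
qed

lemma edges_cross_imp_interleaved:
  assumes cross: "edges_cross (natural_cyclic_order n) {x, y} {x', y'}"
    and range: "{x, y, x', y'} \<subseteq> {1..n}"
    and less: "x < y" "x' < y'"
    and disj: "{x, y} \<inter> {x', y'} = {}"
  shows "x < x' \<and> x' < y \<and> y < y' \<or> x' < x \<and> x < y' \<and> y' < y"
proof (rule ccontr)
  let ?P = "vertex_point (natural_cyclic_order n)"
  assume "\<not> ?thesis"
  \<comment> \<open>Without interleaving, \<open>x'\<close> and \<open>y'\<close> are both inside or
    both outside the interval from \<open>x\<close> to \<open>y\<close>, so they lie on the same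
    side of that chord.\<close>
  then have "(x < x' \<and> x' < y) \<longleftrightarrow> (x < y' \<and> y' < y)"
    using less disj by auto
  then have "orient (?P x) (?P y) (?P x') * orient (?P x) (?P y) (?P y') > 0"
    using orient_natural_neg_iff[of x y x' n] orient_natural_neg_iff[of x y y' n] range less disj
    by (auto simp: zero_less_mult_iff)
  from convex_hulls_disjoint[OF this] cross show False
    by (auto simp: edges_cross_def chord_def)
qed

section \<open>Edges of the circulant\<close>

lemma circulant_edge_cases:
  assumes "e \<in> edges (circulant n {1..k})" "2 * k < n"
  obtains x y where "e = {x, y}" "1 \<le> x" "x < y" "y \<le> n" "y - x \<le> k \<or> n - (y - x) \<le> k"
proof -
  obtain x y i where e: "e = {x, y}" and xy: "x \<in> {1..n}" "y \<in> {1..n}"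
    and i: "i \<in> {1..k}" and cong: "[y = x + i] (mod n)"
    using assms(1) unfolding circulant_def edges_def by auto
  have "int n dvd int y - (int x + int i)"
    using cong unfolding cong_int_iff [symmetric] cong_iff_dvd_diff by simp
  then obtain q where q: "int y - (int x + int i) = int n * q" by (auto simp: dvd_def)
  \<comment> \<open>The bounds leave only \<open>q = 0\<close>, an edge that does not wrap around,
    and \<open>q = - 1\<close>, one that does.\<close>
  have "int n * q < int n * 1" "int n * (- 2) < int n * q"
  proof -
    have "int y \<le> int n" "1 \<le> int y" "int x \<le> int n" "1 \<le> int x" "1 \<le> int i" "2 * int i < int n"
      using xy i assms(2) by auto
    then show "int n * q < int n * 1" "int n * (- 2) < int n * q"
      using q by linarith+
  qed
  then have "q < 1" "q > - 2"
    using mult_less_cancel_left_pos[of "int n"] assms(2) by (metis less_nat_zero_code of_nat_0_less_iff gr0I)+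
  then consider "q = 0" | "q = - 1" by linarith
  then show thesis
  proof cases
    case 1
    then have "y = x + i" using q by simp
    then show ?thesis using that[of x y] e xy i by auto
  next
    case 2
    then have "y + n = x + i" using q by simp
    then have "y < x" "n - (x - y) \<le> k" using xy i assms(2) by auto
    then show ?thesis using that[of y x] e xy by (auto simp: insert_commute)
  qed
qed

lemma short_edge_in_circulant:
  assumes "1 \<le> x" "x < y" "y \<le> n" "y - x \<le> k"
  shows "{x, y} \<in> edges (circulant n {1..k})"
proof -
  have "[y = x + (y - x)] (mod n)" "y - x \<in> {1..k}" using assms by auto
  moreover have "x \<in> {1..n}" "y \<in> {1..n}" using assms by auto
  ultimately show ?thesis unfolding circulant_def edges_def snd_conv by blast
qed

text \<open>An edge as a set forgets which end is the source of the jump; a signed integer offset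
  covers both directions.\<close>

lemma circulant_edge_offset:
  assumes "{x, y} \<in> edges (circulant n {1..k})" "2 * k < n"
  obtains t where "\<bar>t\<bar> \<le> int k" "[int y = int x + t] (mod int n)"
proof -
  obtain a b i where ab: "{x, y} = {a, b}" and i: "i \<in> {1..k}" and cong: "[b = a + i] (mod n)"
    using assms(1) unfolding circulant_def edges_def by auto
  have c: "[int b = int a + int i] (mod int n)"
    using cong by (simp flip: cong_int_iff)
  have c': "[int a = int b + (- int i)] (mod int n)"
    using c by (auto simp: cong_iff_dvd_diff dvd_diff_commute algebra_simps)
  from ab consider "x = a" "y = b" | "x = b" "y = a" by (auto simp: doubleton_eq_iff)
  then show thesis
  proof cases
    case 1 then show ?thesis using that[of "int i"] i c by auto
  next
    case 2 then show ?thesis using that[of "- int i"] i c' by auto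
  qed
qed

lemma small_multiple_eq_zero:
  fixes d r :: int
  assumes "r dvd d" "\<bar>d\<bar> < r"
  shows "d = 0"
  using assms zdvd_not_zless[of "\<bar>d\<bar>" r] by force

section \<open>Upper bound\<close>

text \<open>Neighbours of \<open>x\<close> have offsets from \<open>-k\<close> to \<open>k\<close>,
  and these \<open>2 * k + 1\<close> integers are pairwise incongruent modulo
  \<open>r\<close>.\<close>

lemma same_sum_adjacent_edges_eq:
  assumes edges: "{x, y} \<in> edges (circulant n {1..k})" "{x, y'} \<in> edges (circulant n {1..k})"
    and range: "y \<in> {1..n}" "y' \<in> {1..n}"
    and r: "r = 2 * k + 1" "r dvd n" "n > 0"
    and sum: "[x + y = x + y'] (mod r)"
  shows "y = y'"
proof -
  have kn: "2 * k < n" using r dvd_imp_le[of r n] by simp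
  obtain t where t: "\<bar>t\<bar> \<le> int k" "[int y = int x + t] (mod int n)"
    using circulant_edge_offset[OF edges(1) kn] .
  obtain t' where t': "\<bar>t'\<bar> \<le> int k" "[int y' = int x + t'] (mod int n)"
    using circulant_edge_offset[OF edges(2) kn] .
  have rn: "int r dvd int n" using r(2) by (simp only: of_nat_dvd_iff)
  have "[int y = int y'] (mod int r)"
    using sum by (simp add: cong_add_lcancel_nat cong_int_iff)
  then have "[int x + t = int x + t'] (mod int r)"
    using cong_dvd_modulus[OF t(2) rn] cong_dvd_modulus[OF t'(2) rn]
    by (meson cong_sym cong_trans)
  then have "int r dvd t - t'"
    by (simp add: cong_add_lcancel cong_iff_dvd_diff)
  then have "t = t'"
    using small_multiple_eq_zero[of "int r" "t - t'"] t(1) t'(1) r by auto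
  \<comment> \<open>Equality of the integer offsets lifts the congruence from modulus
    \<open>r\<close> back to modulus \<open>n\<close>.\<close>
  then have "[int y = int y'] (mod int n)"
    using t(2) t'(2) by (meson cong_sym cong_trans)
  then have "int n dvd int y - int y'" by (simp add: cong_iff_dvd_diff)
  then show ?thesis
    using small_multiple_eq_zero[of "int n" "int y - int y'"] range by auto
qed

text \<open>The four ends cut the circle into four arcs. The difference of the two sums is the
  length of one pair of opposite arcs, and \<open>n\<close> minus it that of the other pair;
  congruent sums would make \<open>r\<close> divide both. Each edge spans two adjacent arcs of total
  length at most \<open>k\<close>, and the two spans share one arc. The other two spanned arcs are
  opposite, with positive total length below \<open>2 * k\<close>.\<close>

lemma interleaved_edges_distinct_sum:
  fixes x y x' y' n k r :: nat
  assumes less: "1 \<le> x" "x < x'" "x' < y" "y < y'" "y' \<le> n"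
    and len: "y - x \<le> k \<or> n - (y - x) \<le> k" "y' - x' \<le> k \<or> n - (y' - x') \<le> k"
    and r: "r = 2 * k + 1" "r dvd n"
  shows "\<not> [x + y = x' + y'] (mod r)"
proof
  assume sum: "[x + y = x' + y'] (mod r)"
  let ?d = "int x' + int y' - (int x + int y)"
  have "[int (x' + y') = int (x + y)] (mod int r)"
    using cong_sym[OF sum] by (simp only: cong_int_iff)
  then have d: "int r dvd ?d" by (simp add: cong_iff_dvd_diff)
  moreover have rn: "int r dvd int n" using r(2) by (simp only: of_nat_dvd_iff)
  ultimately have d': "int r dvd int n - ?d" by (rule dvd_diff[rotated])
  have pos: "?d > 0" "int n - ?d > 0" using less len by auto
  have "?d < int r \<or> int n - ?d < int r"
    using less len r by auto
  then show False
    using small_multiple_eq_zero[OF d] small_multiple_eq_zero[OF d'] pos by auto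
qed

lemma sum_mod_matching_book_embedding:
  assumes r: "r = 2 * k + 1" "r dvd n" "n > 0"
  shows "matching_book_embedding (circulant n {1..k}) (natural_cyclic_order n) (\<lambda>e. \<Sum>e mod r)"
proof -
  let ?G = "circulant n {1..k}" and ?w = "natural_cyclic_order n"
  have kn: "2 * k < n" using r dvd_imp_le[of r n] by simp
  have main: "\<not> edges_cross ?w e f \<and> e \<inter> f = {}"
    if ef: "e \<in> edges ?G" "f \<in> edges ?G" and ne: "e \<noteq> f" and col: "\<Sum>e mod r = \<Sum>f mod r" for e f
  proof -
    obtain x y where e: "e = {x, y}" "1 \<le> x" "x < y" "y \<le> n" "y - x \<le> k \<or> n - (y - x) \<le> k"
      using circulant_edge_cases[OF ef(1) kn] .
    obtain x' y' where f: "f = {x', y'}" "1 \<le> x'" "x' < y'" "y' \<le> n"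
        "y' - x' \<le> k \<or> n - (y' - x') \<le> k"
      using circulant_edge_cases[OF ef(2) kn] .
    have sum: "[x + y = x' + y'] (mod r)"
      using col e f by (simp add: cong_def)
    have unique: "b = b'" if "e = {a, b}" "f = {a, b'}" for a b b'
    proof (rule same_sum_adjacent_edges_eq)
      show "{a, b} \<in> edges ?G" "{a, b'} \<in> edges ?G" using that ef by auto
      have "e \<subseteq> {1..n}" "f \<subseteq> {1..n}" using e f by auto
      then show "b \<in> {1..n}" "b' \<in> {1..n}" using that by auto
      \<comment> \<open>Distinct ends are what turns the sum over the edge into
        \<open>a + b\<close>.\<close>
      have "a \<noteq> b" "a \<noteq> b'" using that e f by auto
      then show "[a + b = a + b'] (mod r)"
        using col that by (simp add: cong_def)
    qed (use r in auto)
    have disj: "e \<inter> f = {}"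
    proof (rule ccontr)
      assume "e \<inter> f \<noteq> {}"
      then obtain a where "a \<in> e" "a \<in> f" by blast
      then obtain b b' where "e = {a, b}" "f = {a, b'}" using e(1) f(1) by fast
      then show False using unique ne by blast
    qed
    have "\<not> edges_cross ?w e f"
    proof
      assume "edges_cross ?w e f"
      then have "x < x' \<and> x' < y \<and> y < y' \<or> x' < x \<and> x < y' \<and> y' < y"
        using e f disj by (intro edges_cross_imp_interleaved[of n]) auto
      then show False
        using interleaved_edges_distinct_sum[of x x' y y' n k r]
          interleaved_edges_distinct_sum[of x' x y' y n k r] e f r sum
        by (auto simp: cong_sym)
    qed
    with disj show ?thesis by simp
  qed
  have "finite_simple_graph ?G"
    using kn by (intro finite_simple_graph_circulant) auto
  moreover have "cyclic_order_on (vertices ?G) ?w"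
    by (auto simp: cyclic_order_on_def vertices_def circulant_def natural_cyclic_order_def)
  ultimately show ?thesis
    using main by (auto simp: matching_book_embedding_def)
qed

section \<open>Lower bound\<close>

lemma matching_book_embedding_needs_more_pages:
  assumes mbe: "matching_book_embedding (circulant n {1..k}) (natural_cyclic_order n) c"
    and k: "2 \<le> k" "2 * k < n"
  shows "2 * k < card (c ` edges (circulant n {1..k}))"
proof (rule ccontr)
  let ?E = "edges (circulant n {1..k})" and ?w = "natural_cyclic_order n"
  \<comment> \<open>Around the vertex \<open>k + 1\<close> the neighbourhood does not wrap around modulo \<open>n\<close>.\<close>
  define N where "N = {1..2 * k + 1} - {k + 1}"
  assume "\<not> 2 * k < card (c ` ?E)"
  moreover have "finite ?E"
  proof (rule finite_subset)
    show "?E \<subseteq> Pow {1..n}" by (auto simp: edges_def circulant_def)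
  qed simp
  moreover have star: "{k + 1, w} \<in> ?E" if "w \<in> N" for w
  proof (cases "w < k + 1")
    case True
    then show ?thesis
      using short_edge_in_circulant[of w "k + 1" n k] that k by (auto simp: N_def insert_commute)
  next
    case False
    then show ?thesis
      using short_edge_in_circulant[of "k + 1" w n k] that k by (auto simp: N_def)
  qed
  have proper: "\<not> edges_cross ?w e f" "e \<inter> f = {}"
    if "e \<in> ?E" "f \<in> ?E" "e \<noteq> f" "c e = c f" for e f
    using mbe that by (auto simp: matching_book_embedding_def)
  have "inj_on (\<lambda>w. c {k + 1, w}) N"
  proof (rule inj_onI)
    fix w w' assume "w \<in> N" "w' \<in> N" "c {k + 1, w} = c {k + 1, w'}"
    then have "{k + 1, w} = {k + 1, w'}"
      using proper(2)[OF star star] by blast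
    then show "w = w'" by (auto simp: doubleton_eq_iff)
  qed
  then have "card ((\<lambda>w. c {k + 1, w}) ` N) = 2 * k"
    by (simp add: card_image N_def)
  moreover have "(\<lambda>w. c {k + 1, w}) ` N \<subseteq> c ` ?E" using star by blast
  \<comment> \<open>By assumption there are at most \<open>2 * k\<close> pages, so the
    \<open>2 * k\<close> colours seen at \<open>k + 1\<close> exhaust them.\<close>
  ultimately have all: "(\<lambda>w. c {k + 1, w}) ` N = c ` ?E"
    by (intro card_seteq) auto
  \<comment> \<open>This edge has length 2, so it exists because \<open>2 \<le> k\<close>.\<close>
  have e: "{k, k + 2} \<in> ?E"
    using short_edge_in_circulant[of k "k + 2" n k] k by auto
  then obtain w where w: "w \<in> N" "c {k, k + 2} = c {k + 1, w}"
    using all by (metis (no_types, lifting) image_iff)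
  have "{k, k + 2} \<noteq> {k + 1, w}" by (auto simp: doubleton_eq_iff)
  \<comment> \<open>Both orders are kept: the position of \<open>w\<close> decides which edge has
    the smallest end.\<close>
  note ncr = proper[OF e star[OF w(1)] this w(2)]
    and ncr' = proper[OF star[OF w(1)] e this[symmetric] w(2)[symmetric]]
  \<comment> \<open>Hence \<open>w\<close> lies outside the range from \<open>k\<close> to
    \<open>k + 2\<close>, while \<open>k + 1\<close> lies inside.\<close>
  have "w \<noteq> k" "w \<noteq> k + 2" "w \<noteq> k + 1" using ncr(2) w(1) by (auto simp: N_def)
  then consider "w < k" | "k + 2 < w" by linarith
  then show False
  proof cases
    case 1
    then have "edges_cross ?w {w, k + 1} {k, k + 2}"
      using w(1) k by (intro interleaved_edges_cross) (auto simp: N_def)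
    then show False using ncr' by (simp add: insert_commute)
  next
    case 2
    then have "edges_cross ?w {k, k + 2} {k + 1, w}"
      using w(1) k by (intro interleaved_edges_cross) (auto simp: N_def)
    then show False using ncr by simp
  qed
qed

theorem theorem7:
  fixes r k n :: nat
  assumes "r = 2 * k + 1" and "r \<ge> 5" and "n > 0" and "r dvd n"
  shows "mbt (circulant n {1..k}) (natural_cyclic_order n) = 2 * k + 1"
proof -
  let ?G = "circulant n {1..k}" and ?w = "natural_cyclic_order n"
  let ?c = "\<lambda>e. \<Sum>e mod r"
  have k: "2 \<le> k" "2 * k < n" using assms dvd_imp_le[of r n] by auto
  have lower: "2 * k + 1 \<le> card (c ` edges ?G)" if "matching_book_embedding ?G ?w c" for c
    using matching_book_embedding_needs_more_pages[OF that k] by simp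
  have mbe: "matching_book_embedding ?G ?w ?c"
    using assms by (intro sum_mod_matching_book_embedding)
  have "card (?c ` edges ?G) \<le> card {..<r}"
    using assms by (intro card_mono) auto
  \<comment> \<open>The least number must be attained exactly; the lower bound, applied to this
    colouring itself, shows that every residue occurs.\<close>
  then have "card (?c ` edges ?G) = 2 * k + 1"
    using lower[OF mbe] assms by simp
  then show ?thesis
    unfolding mbt_def using mbe lower by (intro Least_equality) blast+
qed

end
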